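(* Let $I\in\mathbb{S}$ be fixed and let $f,g\in L^2(\mathbb{R},\mathbb{H})$. Then $$\langle\mathcal{V}_\varphi f,\mathcal{V}_\varphi g\rangle_{L^2(\mathbb{R}^2,\mathbb{H})}=2\,\langle f,g\rangle_{L^2(\mathbb{R},\mathbb{H})}.$$
   Context: $\mathbb{H}$ is the algebra of real quaternions, $\mathbb{S}=\{q\in\mathbb{H}:q^2=-1\}$. $L^2(\mathbb{R},\mathbb{H})$ and $L^2(\mathbb{R}^2,\mathbb{H})$ are the spaces of square integrable $\mathbb{H}$-valued functions with ($\mathbb{H}$-valued) inner product $\langle F,G\rangle=\int\overline{G}F$. The quaternionic Segal-Bargmann transform with parameter $\nu=2\pi$ is $\mathcal{B}^S_{\mathbb{H}}(f)(q)=\int_{\mathbb{R}}2^{3/4}e^{-\pi(q^2+t^2)+2\pi\sqrt2\,qt}f(t)\,dt$, $q\in\mathbb{H}$. Let $\varphi(t)=2^{1/4}e^{-\pi t^2}$. For $I\in\mathbb{S}$ fixed, the 1D quaternion short-time Fourier transform (QSTFT) of $f\in L^2(\mathbb{R},\mathbb{H})$ with window $\varphi$ is $$\mathcal{V}_\varphi f(x,\omega)=e^{-I\pi x\omega}\,\mathcal{B}^S_{\mathbb{H}}(f)\!\left(\frac{\bar q}{\sqrt2}\right)e^{-\frac{\pi|q|^2}{2}},\qquad q=x+I\omega,\ (x,\omega)\in\mathbb{R}^2.$$ *)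

theory Defs
  imports "HOL-Analysis.Analysis"
begin

datatype quat = Quat (q_re: real) (q_i: real) (q_j: real) (q_k: real)

lemma quat_eq_iff:
  "p = q \<longleftrightarrow> q_re p = q_re q \<and> q_i p = q_i q \<and> q_j p = q_j q \<and> q_k p = q_k q"
  by (cases p; cases q) simp

instantiation quat :: real_vector
begin

definition "0 = Quat 0 0 0 0"
definition "p + q = Quat (q_re p + q_re q) (q_i p + q_i q) (q_j p + q_j q) (q_k p + q_k q)"
definition "p - q = Quat (q_re p - q_re q) (q_i p - q_i q) (q_j p - q_j q) (q_k p - q_k q)"
definition "- q = Quat (- q_re q) (- q_i q) (- q_j q) (- q_k q)"
definition "r *\<^sub>R q = Quat (r * q_re q) (r * q_i q) (r * q_j q) (r * q_k q)"

instance
  by standard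
    (simp_all add: quat_eq_iff zero_quat_def plus_quat_def minus_quat_def uminus_quat_def
      scaleR_quat_def algebra_simps)

end

instantiation quat :: euclidean_space
begin

definition "inner p q = q_re p * q_re q + q_i p * q_i q + q_j p * q_j q + q_k p * q_k q"
definition "norm (q :: quat) = sqrt ((q_re q)\<^sup>2 + (q_i q)\<^sup>2 + (q_j q)\<^sup>2 + (q_k q)\<^sup>2)"
definition "sgn (q :: quat) = q /\<^sub>R norm q"
definition "dist (p :: quat) q = norm (p - q)"
definition [code del]:
  "(uniformity :: (quat \<times> quat) filter) = (INF e\<in>{0 <..}. principal {(x, y). dist x y < e})"
definition [code del]:
  "open (U :: quat set) \<longleftrightarrow> (\<forall>x\<in>U. eventually (\<lambda>(x', y). x' = x \<longrightarrow> y \<in> U) uniformity)"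
definition "Basis = {Quat 1 0 0 0, Quat 0 1 0 0, Quat 0 0 1 0, Quat 0 0 0 1}"

instance
proof
  fix p q r :: quat and a :: real
  show "inner p p = 0 \<longleftrightarrow> p = 0"
  proof
    assume "inner p p = 0"
    then have "q_re p * q_re p + q_i p * q_i p + q_j p * q_j p + q_k p * q_k p = 0"
      by (simp add: inner_quat_def)
    moreover have "0 \<le> q_re p * q_re p" "0 \<le> q_i p * q_i p" "0 \<le> q_j p * q_j p" "0 \<le> q_k p * q_k p"
      by simp_all
    ultimately have "q_re p * q_re p = 0" "q_i p * q_i p = 0" "q_j p * q_j p = 0" "q_k p * q_k p = 0"
      by linarith+
    then show "p = 0" by (simp add: quat_eq_iff zero_quat_def)
  qed (simp add: inner_quat_def zero_quat_def)
  show "(\<forall>u\<in>Basis. inner p u = 0) \<longleftrightarrow> p = 0"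
    by (simp add: Basis_quat_def inner_quat_def zero_quat_def quat_eq_iff[of p])
qed (auto simp: inner_quat_def norm_quat_def sgn_quat_def dist_quat_def uniformity_quat_def
      open_quat_def Basis_quat_def plus_quat_def scaleR_quat_def power2_eq_square algebra_simps)

end

text \<open>Hamilton's multiplication, \<open>i\<^sup>2 = j\<^sup>2 = k\<^sup>2 = ijk = -1\<close>.\<close>

instantiation quat :: real_normed_div_algebra
begin

definition "1 = Quat 1 0 0 0"
definition "p * q = Quat
  (q_re p * q_re q - q_i p * q_i q - q_j p * q_j q - q_k p * q_k q)
  (q_re p * q_i q + q_i p * q_re q + q_j p * q_k q - q_k p * q_j q)
  (q_re p * q_j q - q_i p * q_k q + q_j p * q_re q + q_k p * q_i q)
  (q_re p * q_k q + q_i p * q_j q - q_j p * q_i q + q_k p * q_re q)"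
definition "inverse q = Quat (q_re q) (- q_i q) (- q_j q) (- q_k q) /\<^sub>R (norm q)\<^sup>2"
definition "p div q = p * inverse (q :: quat)"

instance
proof
  fix p q r :: quat and a :: real
  have nz: "(norm p)\<^sup>2 = (q_re p)\<^sup>2 + (q_i p)\<^sup>2 + (q_j p)\<^sup>2 + (q_k p)\<^sup>2" for p :: quat
    by (simp add: norm_quat_def)
  show "norm (p * q) = norm p * norm q"
    unfolding norm_quat_def real_sqrt_mult[symmetric]
    by (rule arg_cong[of _ _ sqrt]) (simp add: times_quat_def power2_eq_square algebra_simps)
  have inv: "inverse p * p = 1 \<and> p * inverse p = 1" if "p \<noteq> 0"
  proof -
    define c where "c = inverse ((norm p)\<^sup>2)"
    have "c * ((q_re p)\<^sup>2 + (q_i p)\<^sup>2 + (q_j p)\<^sup>2 + (q_k p)\<^sup>2) = 1"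
      using that unfolding nz[symmetric] c_def by simp
    then show ?thesis
      unfolding inverse_quat_def c_def[symmetric]
      by (simp add: times_quat_def scaleR_quat_def one_quat_def power2_eq_square algebra_simps)
  qed
  show "inverse p * p = 1" if "p \<noteq> 0" using inv[OF that] by blast
  show "p * inverse p = 1" if "p \<noteq> 0" using inv[OF that] by blast
qed (simp_all add: quat_eq_iff zero_quat_def one_quat_def plus_quat_def times_quat_def
      scaleR_quat_def inverse_quat_def divide_quat_def algebra_simps)

end

definition qcnj :: "quat \<Rightarrow> quat" where
  "qcnj q = Quat (q_re q) (- q_i q) (- q_j q) (- q_k q)"

definition imag_sphere :: "quat set" where
  "imag_sphere = {q. q\<^sup>2 = - 1}"

text \<open>Elements of \<open>L\<^sup>2\<close> are represented by functions, without passing to classes modulo null sets;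
  measurability is with respect to the completed (Lebesgue) measure.\<close>

definition L2 :: "('a::euclidean_space \<Rightarrow> quat) set" where
  "L2 = {F. F \<in> borel_measurable lebesgue \<and> integrable lebesgue (\<lambda>x. (norm (F x))\<^sup>2)}"

definition L2_inner :: "('a::euclidean_space \<Rightarrow> quat) \<Rightarrow> ('a \<Rightarrow> quat) \<Rightarrow> quat" where
  "L2_inner F G = integral\<^sup>L lebesgue (\<lambda>x. qcnj (G x) * F x)"

text \<open>The quaternionic Segal--Bargmann transform with parameter \<open>\<nu> = 2\<pi>\<close>. The kernel multiplies
  \<open>f t\<close> from the left.\<close>

definition segal_bargmann :: "(real \<Rightarrow> quat) \<Rightarrow> quat \<Rightarrow> quat" where
  "segal_bargmann f q = integral\<^sup>L lebesgue (\<lambda>t.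
     (2 powr (3/4)) *\<^sub>R
       exp (- (pi *\<^sub>R (q\<^sup>2 + of_real (t\<^sup>2))) + (2 * pi * sqrt 2) *\<^sub>R (q * of_real t)) * f t)"

text \<open>The short-time Fourier transform for the Gaussian window \<open>\<phi>(t) = 2 powr (1/4) * exp (- \<pi> t\<^sup>2)\<close>,
  with \<open>(x, \<omega>)\<close> identified with \<open>q = x + I\<omega>\<close>. It is defined through the Segal--Bargmann transform, so the
  window enters only through that kernel.\<close>

definition qstft :: "quat \<Rightarrow> (real \<Rightarrow> quat) \<Rightarrow> real \<times> real \<Rightarrow> quat" where
  "qstft I f = (\<lambda>(x, \<omega>). let q = of_real x + I * of_real \<omega> in
     exp (- (I * of_real (pi * x * \<omega>))) * segal_bargmann f (qcnj q /\<^sub>R sqrt 2)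
       * of_real (exp (- (pi * (norm q)\<^sup>2 / 2))))"

end

(* Expanding the Segal-Bargmann kernel, the Gaussian factors in x and \<omega> combine so that
   V f (x, \<omega>) = 2 powr (3/4) * integral of exp (-2 \<pi> I \<omega> t) * (exp (-\<pi> (t - x)^2) * f t) dt.
   For fixed x, Plancherel's theorem in \<omega> for this left quaternionic Fourier transform followed by
   Tonelli in x gives norm (V f)^2 = 2 * norm f^2, since the integral of 2 powr (3/2) * exp (-2 \<pi> (t - x)^2)
   over x is 2.  Plancherel is obtained with a Gaussian cutoff in \<omega>, which turns norm (F^)^2 into an average
   of the autocorrelation of F near 0, and monotone convergence.  As V is additive and commutes with
   multiplication by quaternions on the right, polarization yields the real inner products of V f with
   V g * u for every quaternion u, and these determine the quaternionic inner product. *)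
theory Submission
  imports Defs "HOL-Probability.Probability"
begin

section \<open>Square integrable functions: continuous approximation, translation,
  autocorrelation\<close>

lemma norm_add_square_le:
  fixes a b :: "'a::real_inner"
  shows "(norm (a + b))\<^sup>2 \<le> 2 * (norm a)\<^sup>2 + 2 * (norm b)\<^sup>2"
  \<comment> \<open>By the parallelogram law the two sides differ by exactly
    \<open>(norm (a - b))\<^sup>2\<close>.\<close>
  using zero_le_power2[of "norm (a - b)"]
  by (simp only: power2_norm_eq_inner) (simp add: inner_add inner_diff inner_commute)

lemma integrable_norm_add_square:
  fixes F G :: "'a \<Rightarrow> 'b::euclidean_space"
  assumes [measurable]: "F \<in> borel_measurable M" "G \<in> borel_measurable M"
    and "integrable M (\<lambda>x. (norm (F x))\<^sup>2)" "integrable M (\<lambda>x. (norm (G x))\<^sup>2)"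
  shows "integrable M (\<lambda>x. (norm (F x + G x))\<^sup>2)"
proof (rule Bochner_Integration.integrable_bound)
  show "integrable M (\<lambda>x. 2 * (norm (F x))\<^sup>2 + 2 * (norm (G x))\<^sup>2)"
    using assms by simp
  show "AE x in M. norm ((norm (F x + G x))\<^sup>2) \<le> norm (2 * (norm (F x))\<^sup>2 + 2 * (norm (G x))\<^sup>2)"
    by (intro AE_I2) (use norm_add_square_le in \<open>force\<close>)
qed simp

text \<open>Polarization writes the inner product as a combination of three squared norms, each of
  which is integrable.\<close>

lemma integrable_inner_L2:
  fixes F G :: "'a \<Rightarrow> 'b::euclidean_space"
  assumes [measurable]: "F \<in> borel_measurable M" "G \<in> borel_measurable M"
    and "integrable M (\<lambda>x. (norm (F x))\<^sup>2)" "integrable M (\<lambda>x. (norm (G x))\<^sup>2)"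
  shows "integrable M (\<lambda>x. F x \<bullet> G x)"
proof -
  have "integrable M (\<lambda>x. ((norm (F x + G x))\<^sup>2 - (norm (F x))\<^sup>2 - (norm (G x))\<^sup>2) / 2)"
    using assms integrable_norm_add_square[OF assms] by simp
  then show ?thesis by (simp add: dot_norm[symmetric])
qed

text \<open>Density of the bounded continuous functions of compact support. First \<open>F\<close>
  is truncated in the argument and in the values; the truncation is then an almost everywhere limit
  of continuous functions, which a cutoff and a projection onto a ball make dominated.\<close>

lemma L2_approx_continuous:
  fixes F :: "real \<Rightarrow> 'b::euclidean_space"
  assumes [measurable]: "F \<in> borel_measurable borel"
    and int: "integrable lborel (\<lambda>x. (norm (F x))\<^sup>2)" and "e > 0"
  obtains g R B where "continuous_on UNIV g" "\<And>x. \<bar>x\<bar> > R \<Longrightarrow> g x = 0" "\<And>x. norm (g x) \<le> B"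
    "integrable lborel (\<lambda>x. (norm (F x - g x))\<^sup>2)" "(\<integral>x. (norm (F x - g x))\<^sup>2 \<partial>lborel) < e"
proof -
  define T where "T m t = (if \<bar>t\<bar> \<le> real m \<and> norm (F t) \<le> real m then F t else 0)" for m t
  have Tm [measurable]: "T m \<in> borel_measurable borel" for m
    unfolding T_def by measurable
  have Tlim: "(\<lambda>m. T m t) \<longlonglongrightarrow> F t" for t
  proof (rule tendsto_eventually)
    obtain k :: nat where k: "max \<bar>t\<bar> (norm (F t)) \<le> real k"
      using real_arch_simple by blast
    show "eventually (\<lambda>m. T m t = F t) sequentially"
      using eventually_ge_at_top[of k] by eventually_elim (use k in \<open>auto simp: T_def\<close>)
  qed
  have Tint: "integrable lborel (\<lambda>t. (norm (F t - T m t))\<^sup>2)" for m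
    by (rule Bochner_Integration.integrable_bound[OF int]) (auto simp: T_def)
  have "(\<lambda>m. \<integral>t. (norm (F t - T m t))\<^sup>2 \<partial>lborel) \<longlonglongrightarrow> (\<integral>t. 0 \<partial>(lborel :: real measure))"
  proof (rule integral_dominated_convergence[where w="\<lambda>t. (norm (F t))\<^sup>2"])
    show "integrable lborel (\<lambda>t. (norm (F t))\<^sup>2)" by (rule int)
    show "AE t in lborel. (\<lambda>m. (norm (F t - T m t))\<^sup>2) \<longlonglongrightarrow> 0"
      by (intro AE_I2) (auto intro!: tendsto_eq_intros Tlim)
    show "\<And>m. AE t in lborel. norm ((norm (F t - T m t))\<^sup>2) \<le> (norm (F t))\<^sup>2"
      by (auto simp: T_def)
  qed simp_all
  then have "(\<lambda>m. \<integral>t. (norm (F t - T m t))\<^sup>2 \<partial>lborel) \<longlonglongrightarrow> 0" by simp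
  \<comment> \<open>Each of the two approximation errors is doubled by
    \<open>norm_add_square_le\<close>, so \<open>e / 4\<close> for each leaves a total below
    \<open>e\<close>.\<close>
  then have "eventually (\<lambda>m. (\<integral>t. (norm (F t - T m t))\<^sup>2 \<partial>lborel) < e / 4) sequentially"
    by (rule order_tendstoD) (use \<open>e > 0\<close> in simp)
  then obtain m where m: "(\<integral>t. (norm (F t - T m t))\<^sup>2 \<partial>lborel) < e / 4"
    by (meson eventually_sequentially order_refl)
  \<comment> \<open>This form of measurability supplies continuous functions converging off a
    negligible set, but with no control of their size or support.\<close>
  have "T m measurable_on UNIV"
    by (rule lebesgue_measurable_imp_measurable_on)
       (auto intro: measurable_completion)
  then obtain N g where N: "negligible N" and g: "\<And>n. continuous_on UNIV (g n)"
    and glim: "\<And>x. x \<notin> N \<Longrightarrow> (\<lambda>n::nat. g n x) \<longlonglongrightarrow> T m x"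
    unfolding measurable_on_def by auto
  \<comment> \<open>\<open>c\<close> is 1 where \<open>T m\<close> may be nonzero and falls to 0
    over a margin of length 1, which keeps it continuous; \<open>P\<close> is the metric projection
    onto the ball that contains the values of \<open>T m\<close>. Both leave \<open>T m\<close>
    unchanged, so the modified approximants \<open>h n\<close> have the same limit.\<close>
  define c where "c t = max 0 (min 1 (real m + 1 - \<bar>t\<bar>))" for t :: real
  define P where "P = closest_point (cball (0::'b) (real m))"
  have P_cont: "continuous_on UNIV P" unfolding P_def
    by (intro continuous_on_closest_point) auto
  have P_le: "norm (P x) \<le> real m" for x
    using closest_point_in_set[of "cball (0::'b) (real m)" x] by (simp add: P_def)
  have P_id: "P x = x" if "norm x \<le> real m" for x
    using that by (simp add: P_def closest_point_self)
  define h where "h n t = c t *\<^sub>R P (g n t)" for n t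
  have h_cont: "continuous_on UNIV (h n)" for n
    unfolding h_def c_def
    by (intro continuous_intros continuous_on_compose2[OF P_cont g]) auto
  then have h_meas [measurable]: "h n \<in> borel_measurable borel" for n
    by (rule borel_measurable_continuous_onI)
  have c01: "0 \<le> c t" "c t \<le> 1" for t by (auto simp: c_def)
  have h_le: "norm (h n t) \<le> real m" for n t
    using mult_mono[OF c01(2)[of t] P_le[of "g n t"]] c01(1)[of t] by (simp add: h_def)
  have h0: "h n t = 0" if "\<bar>t\<bar> > real m + 1" for n t
    using that by (simp add: h_def c_def)
  have T_le: "norm (T m t) \<le> real m" for t by (simp add: T_def)
  have T0: "c t *\<^sub>R P (T m t) = T m t" for t
    by (simp add: P_id[OF T_le]) (auto simp: c_def T_def)
  let ?w = "\<lambda>t. (2 * real m)\<^sup>2 * indicat_real {- (real m + 1)..real m + 1} t"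
  have Dle: "(norm (T m t - h n t))\<^sup>2 \<le> ?w t" for n t
  proof (cases "\<bar>t\<bar> > real m + 1")
    case True
    then show ?thesis using h0[OF True] by (simp add: T_def)
  next
    case False
    have "norm (T m t - h n t) \<le> 2 * real m"
      using norm_triangle_ineq4[of "T m t" "h n t"] T_le[of t] h_le[of n t] by linarith
    then show ?thesis using False power_mono[of "norm (T m t - h n t)" "2 * real m" 2]
      by (auto simp: indicator_def)
  qed
  have w_int: "integrable lborel ?w"
    by (intro integrable_mult_right) (auto simp: integrable_indicator_iff)
  have Dint: "integrable lborel (\<lambda>t. (norm (T m t - h n t))\<^sup>2)" for n
    by (rule Bochner_Integration.integrable_bound[OF w_int]) (use Dle in auto)
  have "(\<lambda>n. \<integral>t. (norm (T m t - h n t))\<^sup>2 \<partial>lborel) \<longlonglongrightarrow> (\<integral>t. 0 \<partial>(lborel :: real measure))"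
  proof (rule integral_dominated_convergence[where w="?w"])
    show "integrable lborel ?w" by (rule w_int)
    have "AE t in lborel. t \<notin> N"
      using AE_not_in[of N lebesgue] N by (simp add: negligible_iff_null_sets AE_completion_iff)
    then show "AE t in lborel. (\<lambda>n. (norm (T m t - h n t))\<^sup>2) \<longlonglongrightarrow> 0"
    proof eventually_elim
      case (elim t)
      have "(\<lambda>n. P (g n t)) \<longlonglongrightarrow> P (T m t)"
        using isCont_tendsto_compose[OF _ glim[OF elim], of P] P_cont
        by (simp add: continuous_on_eq_continuous_at)
      then have "(\<lambda>n. h n t) \<longlonglongrightarrow> T m t"
        unfolding h_def by (subst T0[symmetric]) (intro tendsto_intros)
      from tendsto_power[OF tendsto_norm[OF tendsto_diff[OF tendsto_const[of "T m t"] this]], of 2]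
      show ?case by simp
    qed
    show "\<And>n. AE t in lborel. norm ((norm (T m t - h n t))\<^sup>2) \<le> ?w t"
      using Dle by auto
  qed simp_all
  then have "(\<lambda>n. \<integral>t. (norm (T m t - h n t))\<^sup>2 \<partial>lborel) \<longlonglongrightarrow> 0" by simp
  then have "eventually (\<lambda>n. (\<integral>t. (norm (T m t - h n t))\<^sup>2 \<partial>lborel) < e / 4) sequentially"
    by (rule order_tendstoD) (use \<open>e > 0\<close> in simp)
  then obtain n where n: "(\<integral>t. (norm (T m t - h n t))\<^sup>2 \<partial>lborel) < e / 4"
    by (meson eventually_sequentially order_refl)
  have split: "(norm (F t - h n t))\<^sup>2 \<le> 2 * (norm (F t - T m t))\<^sup>2 + 2 * (norm (T m t - h n t))\<^sup>2" for t
    using norm_add_square_le[of "F t - T m t" "T m t - h n t"] by simp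
  have sint: "integrable lborel (\<lambda>t. 2 * (norm (F t - T m t))\<^sup>2 + 2 * (norm (T m t - h n t))\<^sup>2)"
    using Tint Dint by simp
  have fint: "integrable lborel (\<lambda>t. (norm (F t - h n t))\<^sup>2)"
    by (rule Bochner_Integration.integrable_bound[OF sint]) (use split in \<open>auto intro!: AE_I2 simp: abs_of_nonneg\<close>)
  have "(\<integral>t. (norm (F t - h n t))\<^sup>2 \<partial>lborel) \<le> (\<integral>t. 2 * (norm (F t - T m t))\<^sup>2 + 2 * (norm (T m t - h n t))\<^sup>2 \<partial>lborel)"
    by (intro integral_mono fint sint split)
  also have "\<dots> < e"
    using m n Tint Dint by simp
  finally show thesis
    using that[OF h_cont h0 h_le fint] by blast
qed

lemma integrable_translate:
  fixes f :: "real \<Rightarrow> 'b::{banach,second_countable_topology}"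
  shows "integrable lborel f \<Longrightarrow> integrable lborel (\<lambda>t. f (t + h))"
  using lborel_integrable_real_affine[of f 1 h] by (simp add: add.commute)

lemma integral_translate:
  fixes f :: "real \<Rightarrow> 'b::{banach,second_countable_topology}"
  shows "(\<integral>t. f (t + h) \<partial>lborel) = (\<integral>t. f t \<partial>lborel)"
  using lborel_integral_real_affine[of 1 f h] by (simp add: add.commute)

text \<open>For a continuous function of compact support this is dominated convergence. The general
  case follows by approximation, since translation invariance makes the error of the shifted
  function equal to that of the original.\<close>

lemma L2_translation_continuous:
  fixes F :: "real \<Rightarrow> 'b::euclidean_space"
  assumes [measurable]: "F \<in> borel_measurable borel"
    and int: "integrable lborel (\<lambda>x. (norm (F x))\<^sup>2)" and h: "h \<longlonglongrightarrow> 0"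
  shows "(\<lambda>k. \<integral>t. (norm (F (t + h k) - F t))\<^sup>2 \<partial>lborel) \<longlonglongrightarrow> 0"
proof (rule LIMSEQ_I)
  fix e :: real assume "e > 0"
  \<comment> \<open>The error of \<open>g\<close> enters the final estimate with total weight 8 and
    the term for \<open>g\<close> with weight 2, so \<open>e / 16\<close> here and
    \<open>e / 4\<close> below contribute \<open>e / 2\<close> each.\<close>
  obtain g R B where g: "continuous_on UNIV g" and g0: "\<And>x. \<bar>x\<bar> > R \<Longrightarrow> g x = 0"
    and gB: "\<And>x. norm (g x) \<le> B" and gint: "integrable lborel (\<lambda>x. (norm (F x - g x))\<^sup>2)"
    and ge: "(\<integral>x. (norm (F x - g x))\<^sup>2 \<partial>lborel) < e / 16"
    using L2_approx_continuous[OF assms(1) int, of "e / 16"] \<open>e > 0\<close> by auto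
  have [measurable]: "g \<in> borel_measurable borel" by (rule borel_measurable_continuous_onI[OF g])
  let ?w = "\<lambda>t. (2 * B)\<^sup>2 * indicat_real {- (\<bar>R\<bar> + 1)..\<bar>R\<bar> + 1} t"
  have w_int: "integrable lborel ?w"
    by (intro integrable_mult_right) (auto simp: integrable_indicator_iff)
  have wle: "(norm (g (t + d) - g t))\<^sup>2 \<le> ?w t" if "\<bar>d\<bar> \<le> 1" for t d
  proof (cases "\<bar>t\<bar> > \<bar>R\<bar> + 1")
    case True
    then have "g t = 0" "g (t + d) = 0" using that by (auto intro!: g0)
    then show ?thesis by simp
  next
    case False
    have "norm (g (t + d) - g t) \<le> 2 * B"
      using norm_triangle_ineq4[of "g (t + d)" "g t"] gB[of t] gB[of "t + d"] by linarith
    then show ?thesis using False power_mono[of "norm (g (t + d) - g t)" "2 * B" 2]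
      by (auto simp: indicator_def)
  qed
  obtain K where K: "\<And>k. k \<ge> K \<Longrightarrow> \<bar>h k\<bar> \<le> 1"
    using LIMSEQ_D[OF h, of 1] by force
  have gd_int: "integrable lborel (\<lambda>t. (norm (g (t + d) - g t))\<^sup>2)" if "\<bar>d\<bar> \<le> 1" for d
    by (rule Bochner_Integration.integrable_bound[OF w_int]) (use wle[OF that] in auto)
  \<comment> \<open>The majorant \<open>?w\<close> is valid for shifts of size at most 1, so the
    sequence is started at \<open>K\<close> and the offset removed afterwards.\<close>
  have "(\<lambda>k. \<integral>t. (norm (g (t + h (k + K)) - g t))\<^sup>2 \<partial>lborel) \<longlonglongrightarrow> (\<integral>t. 0 \<partial>(lborel :: real measure))"
  proof (rule integral_dominated_convergence[where w="?w"])
    show "integrable lborel ?w" by (rule w_int)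
    show "AE t in lborel. (\<lambda>k. (norm (g (t + h (k + K)) - g t))\<^sup>2) \<longlonglongrightarrow> 0"
    proof (rule AE_I2)
      fix t
      have "(\<lambda>k. t + h (k + K)) \<longlonglongrightarrow> t"
        using LIMSEQ_ignore_initial_segment[OF h, of K] by (auto intro!: tendsto_eq_intros)
      moreover have "isCont g t" using g by (simp add: continuous_on_eq_continuous_at)
      ultimately have "(\<lambda>k. g (t + h (k + K))) \<longlonglongrightarrow> g t"
        using isCont_tendsto_compose by blast
      from tendsto_power[OF tendsto_norm[OF tendsto_diff[OF this tendsto_const[of "g t"]]], of 2]
      show "(\<lambda>k. (norm (g (t + h (k + K)) - g t))\<^sup>2) \<longlonglongrightarrow> 0"
        by simp
    qed
    show "\<And>k. AE t in lborel. norm ((norm (g (t + h (k + K)) - g t))\<^sup>2) \<le> ?w t"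
      using wle K by auto
  qed simp_all
  then have "(\<lambda>k. \<integral>t. (norm (g (t + h (k + K)) - g t))\<^sup>2 \<partial>lborel) \<longlonglongrightarrow> 0"
    by (simp only: integral_zero)
  then have "(\<lambda>k. \<integral>t. (norm (g (t + h k) - g t))\<^sup>2 \<partial>lborel) \<longlonglongrightarrow> 0"
    by (rule LIMSEQ_offset)
  from LIMSEQ_D[OF this, of "e / 4"] \<open>e > 0\<close>
  obtain K' where K': "\<And>k. k \<ge> K' \<Longrightarrow> (\<integral>t. (norm (g (t + h k) - g t))\<^sup>2 \<partial>lborel) < e / 4"
    by force
  have "(\<integral>t. (norm (F (t + h k) - F t))\<^sup>2 \<partial>lborel) < e" if "k \<ge> max K K'" for k
  proof -
    have k: "k \<ge> K" "k \<ge> K'" using that by auto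
    \<comment> \<open>The difference is split as \<open>(F - g)\<close> at the shifted point, minus
      \<open>(F - g)\<close> at \<open>t\<close>, plus the increment of \<open>g\<close>. Two uses
      of \<open>norm_add_square_le\<close> give the weights 4, 4 and 2.\<close>
    let ?b = "\<lambda>t. 4 * (norm (F (t + h k) - g (t + h k)))\<^sup>2 + 4 * (norm (F t - g t))\<^sup>2 + 2 * (norm (g (t + h k) - g t))\<^sup>2"
    have le: "(norm (F (t + h k) - F t))\<^sup>2 \<le> ?b t" for t
      using norm_add_square_le[of "(F (t + h k) - g (t + h k)) - (F t - g t)" "g (t + h k) - g t"]
        norm_add_square_le[of "F (t + h k) - g (t + h k)" "- (F t - g t)"]
      by (simp add: norm_minus_commute algebra_simps)
    note ti = integrable_translate[OF gint, of "h k"]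
    have bint: "integrable lborel ?b" using ti gint gd_int[OF K[OF k(1)]] by simp
    have "integrable lborel (\<lambda>t. (norm (F (t + h k) - F t))\<^sup>2)"
      by (rule Bochner_Integration.integrable_bound[OF bint]) (use le in \<open>auto intro!: AE_I2 simp: abs_of_nonneg\<close>)
    then have "(\<integral>t. (norm (F (t + h k) - F t))\<^sup>2 \<partial>lborel) \<le> (\<integral>t. ?b t \<partial>lborel)"
      by (intro integral_mono bint le)
    also have "\<dots> = 8 * (\<integral>x. (norm (F x - g x))\<^sup>2 \<partial>lborel) + 2 * (\<integral>t. (norm (g (t + h k) - g t))\<^sup>2 \<partial>lborel)"
      using ti gint gd_int[OF K[OF k(1)]] integral_translate[of "\<lambda>t. (norm (F t - g t))\<^sup>2" "h k"] by simp
    also have "\<dots> < e" using ge K'[OF k(2)] by linarith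
    finally show ?thesis .
  qed
  then show "\<exists>no. \<forall>k\<ge>no. norm ((\<integral>t. (norm (F (t + h k) - F t))\<^sup>2 \<partial>lborel) - 0) < e"
    by (intro exI[of _ "max K K'"]) (simp del: max.bounded_iff)
qed

text \<open>Expanding the square and using translation invariance, the autocorrelation at
  \<open>d\<close> is the squared norm of \<open>F\<close> minus half the squared norm of
  \<open>F (t + d) - F t\<close>, and the latter vanishes in the limit.\<close>

lemma autocorrelation_tendsto:
  fixes F :: "real \<Rightarrow> 'b::euclidean_space"
  assumes [measurable]: "F \<in> borel_measurable borel"
    and int: "integrable lborel (\<lambda>x. (norm (F x))\<^sup>2)" and h: "h \<longlonglongrightarrow> 0"
  shows "(\<lambda>k. \<integral>t. F t \<bullet> F (t + h k) \<partial>lborel) \<longlonglongrightarrow> (\<integral>t. (norm (F t))\<^sup>2 \<partial>lborel)"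
proof -
  have eq: "(\<integral>t. F t \<bullet> F (t + d) \<partial>lborel)
      = (\<integral>t. (norm (F t))\<^sup>2 \<partial>lborel) - (\<integral>t. (norm (F (t + d) - F t))\<^sup>2 \<partial>lborel) / 2" for d
  proof -
    note ti = integrable_translate[OF int, of d]
    have p: "(norm (F (t + d) - F t))\<^sup>2 = (norm (F (t + d)))\<^sup>2 + (norm (F t))\<^sup>2 - 2 * (F t \<bullet> F (t + d))" for t
      by (simp only: power2_norm_eq_inner) (simp add: inner_diff inner_commute)
    have "integrable lborel (\<lambda>t. F t \<bullet> F (t + d))"
      by (rule integrable_inner_L2) (use int ti in simp_all)
    then show ?thesis
      unfolding p using int ti integral_translate[of "\<lambda>t. (norm (F t))\<^sup>2" d]
      by (simp add: diff_divide_distrib)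
  qed
  show ?thesis
    unfolding eq using L2_translation_continuous[OF assms] by (auto intro!: tendsto_eq_intros)
qed

section \<open>Imaginary units and the exponentials that they generate\<close>

lemma imag_sphere_components:
  assumes "I \<in> imag_sphere"
  shows "q_re I = 0" "(q_i I)\<^sup>2 + (q_j I)\<^sup>2 + (q_k I)\<^sup>2 = 1"
proof -
  have eq: "I * I = - 1" using assms by (simp add: imag_sphere_def power2_eq_square)
  have r: "q_re I * q_re I - q_i I * q_i I - q_j I * q_j I - q_k I * q_k I = - 1"
    and z: "q_re I * q_i I = 0" "q_re I * q_j I = 0" "q_re I * q_k I = 0"
    using eq by (auto simp: quat_eq_iff times_quat_def one_quat_def uminus_quat_def)
  show re: "q_re I = 0"
  \<comment> \<open>A nonzero real part would force the three imaginary components to vanish, and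
    then the square of \<open>I\<close> would be a nonnegative real.\<close>
  proof (rule ccontr)
    assume "q_re I \<noteq> 0"
    then have "q_re I * q_re I = - 1" using r z by simp
    then show False using zero_le_square[of "q_re I"] by linarith
  qed
  show "(q_i I)\<^sup>2 + (q_j I)\<^sup>2 + (q_k I)\<^sup>2 = 1"
    using r re by (simp add: power2_eq_square)
qed

text \<open>Euler's form of \<open>exp (t *\<^sub>R I)\<close> for an imaginary unit
  \<open>I\<close>; it reduces questions of conjugation and measurability to the real functions
  \<open>cos\<close> and \<open>sin\<close>.\<close>

definition qcis :: "quat \<Rightarrow> real \<Rightarrow> quat" where
  "qcis I t = of_real (cos t) + sin t *\<^sub>R I"

text \<open>Even powers of \<open>I\<close> are real and odd powers are real multiples of
  \<open>I\<close>, with alternating signs, so the exponential series splits into the cosine and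
  sine series.\<close>

lemma exp_scaleR_imag:
  assumes "I \<in> imag_sphere"
  shows "exp (t *\<^sub>R I) = qcis I t"
proof -
  have II: "I * I = - 1" using assms by (simp add: imag_sphere_def power2_eq_square)
  have even: "I ^ (2 * k) = (- 1) ^ k *\<^sub>R 1" for k
    by (simp add: power_mult power2_eq_square II scaleR_conv_of_real)
  have summand: "(t *\<^sub>R I) ^ n /\<^sub>R fact n
      = of_real (cos_coeff n * t ^ n) + (sin_coeff n * t ^ n) *\<^sub>R I" for n
  proof (cases "Parity.even n")
    case True
    then obtain k where n: "n = 2 * k" by blast
    show ?thesis
      by (simp add: n scaleR_power even cos_coeff_def sin_coeff_def of_real_def divide_inverse)
  next
    case False
    then obtain k where n: "n = Suc (2 * k)" by (metis oddE Suc_eq_plus1)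
    have "I ^ n = (- 1) ^ k *\<^sub>R I"
      using even[of k] by (simp add: n power_commutes[symmetric])
    then show ?thesis using False
      by (simp add: scaleR_power cos_coeff_def sin_coeff_def divide_inverse n)
  qed
  have "(\<lambda>n. of_real (cos_coeff n * t ^ n) + (sin_coeff n * t ^ n) *\<^sub>R I) sums qcis I t"
    unfolding qcis_def
    using cos_converges[of t] sin_converges[of t]
    by (intro sums_add sums_of_real sums_scaleR_left) simp_all
  moreover have "(\<lambda>n. (t *\<^sub>R I) ^ n /\<^sub>R fact n) sums exp (t *\<^sub>R I)"
    by (rule exp_converges)
  ultimately show ?thesis
    unfolding summand using sums_unique2 by blast
qed

lemma qcis_mult: "I \<in> imag_sphere \<Longrightarrow> qcis I s * qcis I t = qcis I (s + t)"
  unfolding exp_scaleR_imag[symmetric] scaleR_add_left by (subst exp_add_commuting) simp_all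

lemma of_real_quat: "of_real x = Quat x 0 0 0"
  by (simp add: of_real_def one_quat_def scaleR_quat_def)

lemma qcnj_qcis:
  assumes "I \<in> imag_sphere"
  shows "qcnj (qcis I t) = qcis I (- t)"
  using imag_sphere_components[OF assms]
  by (simp add: qcis_def of_real_quat qcnj_def plus_quat_def scaleR_quat_def)

text \<open>The adjoint of left multiplication by \<open>v\<close> is left multiplication by its
  conjugate.\<close>

lemma inner_mult_left_quat: "inner (u * p) (v * q) = inner (qcnj v * u * p) (q :: quat)"
  by (simp add: inner_quat_def times_quat_def qcnj_def algebra_simps)

text \<open>Moving one phase across the inner product leaves only the difference of the phases. The
  sine term will disappear on integration against an even weight.\<close>

lemma inner_qcis:
  assumes "I \<in> imag_sphere"
  shows "inner (qcis I s * p) (qcis I t * q) = cos (s - t) * inner p q + sin (s - t) * inner (I * p) q"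
proof -
  have "inner (qcis I s * p) (qcis I t * q) = inner (qcis I (s - t) * p) q"
    by (simp add: inner_mult_left_quat qcnj_qcis[OF assms] qcis_mult[OF assms])
  also have "qcis I (s - t) * p = cos (s - t) *\<^sub>R p + sin (s - t) *\<^sub>R (I * p)"
    by (simp add: qcis_def distrib_right scaleR_conv_of_real mult.assoc)
  finally show ?thesis by (simp add: inner_add_left)
qed

lemma norm_qcis:
  assumes "I \<in> imag_sphere"
  shows "norm (qcis I t) = 1"
proof -
  have "norm I ^ 2 = norm (I\<^sup>2)" by (simp add: norm_power)
  then have "inner (qcis I t * 1) (qcis I t * 1) = 1"
    by (subst inner_qcis[OF assms]) (simp add: power2_norm_eq_inner[symmetric])
  then show ?thesis by (simp add: norm_eq_sqrt_inner)
qed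

lemma borel_measurable_qcis [measurable (raw)]:
  assumes [measurable]: "f \<in> borel_measurable M"
  shows "(\<lambda>x. qcis I (f x)) \<in> borel_measurable M"
  unfolding qcis_def of_real_def by measurable

section \<open>Gaussian integrals in the frequency variable\<close>

lemma has_bochner_integral_normal_cos_sin:
  shows "has_bochner_integral lborel (\<lambda>x. std_normal_density x * cos (t * x)) (exp (- t\<^sup>2 / 2))"
    and "has_bochner_integral lborel (\<lambda>x. std_normal_density x * sin (t * x)) 0"
proof -
  have ie: "integrable lborel (\<lambda>x. std_normal_density x *\<^sub>R iexp (t * x))"
    by (rule Bochner_Integration.integrable_bound[OF integrable_normal_density[of 1 0]])
       (auto simp: norm_exp_i_times)
  \<comment> \<open>The integral is the characteristic function of the standard normal law; its real
    and imaginary parts are the two claims.\<close>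
  have "(\<integral>x. std_normal_density x *\<^sub>R iexp (t * x) \<partial>lborel) = char std_normal_distribution t"
    unfolding char_def by (subst integral_density) (auto simp: normal_density_nonneg)
  then have "has_bochner_integral lborel (\<lambda>x. std_normal_density x *\<^sub>R iexp (t * x))
      (complex_of_real (exp (- t\<^sup>2 / 2)))"
    using ie by (simp add: has_bochner_integral_iff char_std_normal_distribution)
  from has_bochner_integral_bounded_linear[OF bounded_linear_Re this]
    has_bochner_integral_bounded_linear[OF bounded_linear_Im this]
  show "has_bochner_integral lborel (\<lambda>x. std_normal_density x * cos (t * x)) (exp (- t\<^sup>2 / 2))"
    and "has_bochner_integral lborel (\<lambda>x. std_normal_density x * sin (t * x)) 0"
    by (simp_all add: Re_exp Im_exp)
qed

text \<open>Scaled so that its Fourier transform with kernel frequency \<open>2 * pi\<close> is the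
  centred normal density of standard deviation \<open>1 / n\<close>: the cutoff increases to 1 while
  its transform is an approximate identity.\<close>

definition gauss_cutoff :: "real \<Rightarrow> real \<Rightarrow> real" where
  "gauss_cutoff n \<omega> = exp (- (2 * pi * \<omega> / n)\<^sup>2 / 2)"

lemma gauss_cutoff_normal: "gauss_cutoff n \<omega> = sqrt (2 * pi) * std_normal_density (2 * pi / n * \<omega>)"
  by (simp add: gauss_cutoff_def std_normal_density_def)

lemma gauss_cutoff_cos_sin:
  assumes "n > 0"
  shows "has_bochner_integral lborel (\<lambda>\<omega>. gauss_cutoff n \<omega> * cos (2 * pi * \<omega> * u))
           (n * std_normal_density (n * u))"
    and "has_bochner_integral lborel (\<lambda>\<omega>. gauss_cutoff n \<omega> * sin (2 * pi * \<omega> * u)) 0"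
proof -
  have c: "2 * pi / n \<noteq> 0" using assms by simp
  \<comment> \<open>Substituting \<open>2 * pi / n * \<omega>\<close> for the variable turns the
    frequency \<open>n * u\<close> into the phase \<open>2 * pi * \<omega> * u\<close>.\<close>
  note A = has_bochner_integral_mult_right[of "sqrt (2 * pi)", OF
      lborel_has_bochner_integral_real_affine_iff[OF c, of _ _ 0, THEN iffD1,
        OF has_bochner_integral_normal_cos_sin(1)[of "n * u"]]]
  note B = has_bochner_integral_mult_right[of "sqrt (2 * pi)", OF
      lborel_has_bochner_integral_real_affine_iff[OF c, of _ _ 0, THEN iffD1,
        OF has_bochner_integral_normal_cos_sin(2)[of "n * u"]]]
  have v: "sqrt (2 * pi) * (exp (- (n * u)\<^sup>2 / 2) /\<^sub>R \<bar>2 * pi / n\<bar>) = n * std_normal_density (n * u)"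
    using assms real_sqrt_mult_self[of "2 * pi"]
    by (simp add: std_normal_density_def field_simps)
  have e: "n * u * (0 + 2 * pi / n * \<omega>) = 2 * pi * \<omega> * u" for \<omega>
    using assms by simp
  show "has_bochner_integral lborel (\<lambda>\<omega>. gauss_cutoff n \<omega> * cos (2 * pi * \<omega> * u))
           (n * std_normal_density (n * u))"
    using A unfolding v e by (simp add: gauss_cutoff_normal mult.assoc)
  show "has_bochner_integral lborel (\<lambda>\<omega>. gauss_cutoff n \<omega> * sin (2 * pi * \<omega> * u)) 0"
    using B unfolding e by (simp add: gauss_cutoff_normal mult.assoc)
qed

lemma integrable_gauss_cutoff: "n > 0 \<Longrightarrow> integrable lborel (gauss_cutoff n)"
  using gauss_cutoff_cos_sin(1)[of n 0] by (simp add: has_bochner_integral_iff)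

lemma integral_gauss_cutoff_qcis:
  assumes "I \<in> imag_sphere" "n > 0"
  shows "(\<integral>\<omega>. gauss_cutoff n \<omega> * inner (qcis I (- 2 * pi * \<omega> * t) * p) (qcis I (- 2 * pi * \<omega> * s) * q) \<partial>lborel)
    = n * std_normal_density (n * (s - t)) * inner p q"
proof -
  have d: "- 2 * pi * \<omega> * t - - 2 * pi * \<omega> * s = 2 * pi * \<omega> * (s - t)" for \<omega>
    by (simp add: algebra_simps)
  note G = gauss_cutoff_cos_sin[OF assms(2), of "s - t"]
  show ?thesis
    unfolding inner_qcis[OF assms(1)] d distrib_left mult.assoc[symmetric]
    using has_bochner_integral_integral_eq[OF has_bochner_integral_add[OF
      has_bochner_integral_mult_left[OF G(1)] has_bochner_integral_mult_left[OF G(2)]]] by simp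
qed

section \<open>The quaternionic Fourier transform and Plancherel's theorem\<close>

lemma integrable_pair_mult:
  fixes f :: "'a \<Rightarrow> real" and g :: "'b \<Rightarrow> real"
  assumes "sigma_finite_measure M" "sigma_finite_measure N"
    and f: "integrable M f" and g: "integrable N g"
  shows "integrable (M \<Otimes>\<^sub>M N) (\<lambda>z. f (fst z) * g (snd z))"
proof -
  interpret pair_sigma_finite M N
    using assms by (simp add: pair_sigma_finite_def)
  have [measurable]: "f \<in> borel_measurable M" "g \<in> borel_measurable N"
    using f g by auto
  show ?thesis
  proof (rule Fubini_integrable)
    have "integrable M (\<lambda>x. \<bar>f x\<bar> * (\<integral>y. \<bar>g y\<bar> \<partial>N))"
      using f by (intro integrable_mult_left integrable_abs)
    then show "integrable M (\<lambda>x. \<integral>y. norm (f (fst (x, y)) * g (snd (x, y))) \<partial>N)"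
      by (simp add: abs_mult)
    show "AE x in M. integrable N (\<lambda>y. f (fst (x, y)) * g (snd (x, y)))"
      using g by simp
  qed measurable
qed

lemmas integrable_lborel_pair_mult =
  integrable_pair_mult[OF lborel.sigma_finite_measure_axioms lborel.sigma_finite_measure_axioms]

text \<open>The kernel stands to the left of \<open>F\<close>, as in the Segal-Bargmann transform,
  so right multiplication by constants passes through.\<close>

definition qfourier :: "quat \<Rightarrow> (real \<Rightarrow> quat) \<Rightarrow> real \<Rightarrow> quat" where
  "qfourier I F \<omega> = (\<integral>t. qcis I (- 2 * pi * \<omega> * t) * F t \<partial>lborel)"

lemma borel_measurable_qfourier [measurable]:
  assumes [measurable]: "F \<in> borel_measurable borel"
  shows "qfourier I F \<in> borel_measurable borel"
  unfolding qfourier_def by measurable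

lemma std_normal_density_le_1: "std_normal_density x \<le> 1"
proof -
  have "1 \<le> sqrt (2 * pi)" using pi_ge_two by simp
  then have "1 / sqrt (2 * pi) \<le> 1" by simp
  then show ?thesis
    unfolding std_normal_density_def by (intro mult_le_one) auto
qed

text \<open>A crude bound that supplies the majorants for the exchanges of integrals in
  \<open>gauss_cutoff_qfourier\<close>.\<close>

lemma normal_density_inner_le:
  fixes a b :: "'a::real_inner"
  shows "std_normal_density x * \<bar>inner a b\<bar> \<le> norm a * norm b"
  using mult_mono[OF std_normal_density_le_1[of x] Cauchy_Schwarz_ineq2[of a b]] by simp

context
  fixes I :: quat and F :: "real \<Rightarrow> quat"
  assumes I: "I \<in> imag_sphere" and int1: "integrable lborel F"
begin

private lemma borel_measurable_of_integrable [measurable]: "F \<in> borel_measurable borel"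
  using int1 by auto

private lemma integrable_norm_F: "integrable lborel (\<lambda>t. norm (F t))"
  using int1 by simp

lemma integrable_qcis_mult: "integrable lborel (\<lambda>t. qcis I (a * t) * F t)"
  by (rule Bochner_Integration.integrable_bound[OF int1]) (auto simp: norm_mult norm_qcis[OF I])

private definition fourier_kernel :: "real \<Rightarrow> real \<times> real \<Rightarrow> real" where
  "fourier_kernel \<omega> z = inner (qcis I (- 2 * pi * \<omega> * fst z) * F (fst z)) (qcis I (- 2 * pi * \<omega> * snd z) * F (snd z))"

private lemma fourier_kernel_measurable [measurable]: "case_prod fourier_kernel \<in> borel_measurable (borel \<Otimes>\<^sub>M (borel \<Otimes>\<^sub>M borel))"
  unfolding fourier_kernel_def by measurable

private lemma fourier_kernel_bound: "\<bar>fourier_kernel \<omega> z\<bar> \<le> norm (F (fst z)) * norm (F (snd z))"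
  using Cauchy_Schwarz_ineq2[of "qcis I (- 2 * pi * \<omega> * fst z) * F (fst z)"
      "qcis I (- 2 * pi * \<omega> * snd z) * F (snd z)"]
  by (simp only: fourier_kernel_def norm_mult norm_qcis[OF I] mult_1)

private lemma integrable_fourier_kernel: "integrable (lborel \<Otimes>\<^sub>M lborel) (fourier_kernel \<omega>)"
proof (rule Bochner_Integration.integrable_bound[OF integrable_lborel_pair_mult[OF integrable_norm_F integrable_norm_F]])
  show "fourier_kernel \<omega> \<in> borel_measurable (lborel \<Otimes>\<^sub>M lborel)" unfolding fourier_kernel_def by measurable
qed (use fourier_kernel_bound in auto)

text \<open>The squared norm is the inner product of the integral with itself; both integrals are
  pulled out, one in each argument, and combined by Fubini.\<close>

private lemma norm_qfourier_square: "(norm (qfourier I F \<omega>))\<^sup>2 = (\<integral>z. fourier_kernel \<omega> z \<partial>(lborel \<Otimes>\<^sub>M lborel))"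
proof -
  note i = integrable_qcis_mult[of "- 2 * pi * \<omega>"]
  have "(norm (qfourier I F \<omega>))\<^sup>2
    = (\<integral>t. inner (qcis I (- 2 * pi * \<omega> * t) * F t) (qfourier I F \<omega>) \<partial>lborel)"
    using integral_inner_left[of "qfourier I F \<omega>", OF i]
    by (simp only: power2_norm_eq_inner qfourier_def)
  also have "\<dots> = (\<integral>t. \<integral>s. fourier_kernel \<omega> (t, s) \<partial>lborel \<partial>lborel)"
    unfolding fourier_kernel_def fst_conv snd_conv using integral_inner_right[OF i]
    by (simp only: qfourier_def)
  also have "\<dots> = (\<integral>z. fourier_kernel \<omega> z \<partial>(lborel \<Otimes>\<^sub>M lborel))"
    by (rule lborel_pair.integral_fst'[OF integrable_fourier_kernel])
  finally show ?thesis .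
qed

text \<open>Integrating over \<omega> first turns the kernel into a narrow normal density in
  \<open>s - t\<close>; rescaling this difference by \<open>n\<close> yields an average of the
  autocorrelation of \<open>F\<close> at the points \<open>y / n\<close>.\<close>

lemma gauss_cutoff_qfourier:
  assumes n: "n > 0"
  shows "integrable lborel (\<lambda>\<omega>. gauss_cutoff n \<omega> * (norm (qfourier I F \<omega>))\<^sup>2)" (is ?A)
    and "(\<integral>\<omega>. gauss_cutoff n \<omega> * (norm (qfourier I F \<omega>))\<^sup>2 \<partial>lborel)
      = (\<integral>y. std_normal_density y * (\<integral>t. inner (F t) (F (t + y / n)) \<partial>lborel) \<partial>lborel)" (is ?B)
proof -
  let ?L2 = "lborel \<Otimes>\<^sub>M lborel :: (real \<times> real) measure"
  have sf: "sigma_finite_measure ?L2"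
    unfolding lborel_prod by (rule lborel.sigma_finite_measure_axioms)
  interpret L: pair_sigma_finite "lborel :: real measure" ?L2
    using sf by (simp add: pair_sigma_finite_def lborel.sigma_finite_measure_axioms)
  have [measurable]: "gauss_cutoff n \<in> borel_measurable borel"
    unfolding gauss_cutoff_def by measurable
  have g0: "gauss_cutoff n \<omega> \<ge> 0" for \<omega> by (simp add: gauss_cutoff_def)
  let ?f = "\<lambda>(\<omega>, z). gauss_cutoff n \<omega> * fourier_kernel \<omega> z"
  \<comment> \<open>The bound on the kernel does not decay in \<omega>; the Gaussian cutoff is what
    makes the triple integral absolutely convergent.\<close>
  have fi: "integrable (lborel \<Otimes>\<^sub>M ?L2) ?f"
  proof (rule Bochner_Integration.integrable_bound)
    show "integrable (lborel \<Otimes>\<^sub>M ?L2) (\<lambda>w. gauss_cutoff n (fst w) * (norm (F (fst (snd w))) * norm (F (snd (snd w)))))"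
      by (rule integrable_pair_mult[OF lborel.sigma_finite_measure_axioms sf integrable_gauss_cutoff[OF n]
           integrable_lborel_pair_mult[OF integrable_norm_F integrable_norm_F]])
    show "AE w in lborel \<Otimes>\<^sub>M ?L2. norm (?f w) \<le> norm (gauss_cutoff n (fst w) * (norm (F (fst (snd w))) * norm (F (snd (snd w)))))"
      using fourier_kernel_bound g0 by (intro AE_I2) (auto simp: abs_mult intro!: mult_left_mono)
    have "?f \<in> borel_measurable (borel \<Otimes>\<^sub>M (borel \<Otimes>\<^sub>M borel))" by measurable
    then show "?f \<in> borel_measurable (lborel \<Otimes>\<^sub>M ?L2)"
      by (simp cong: measurable_cong_sets sets_pair_measure_cong)
  qed
  have eq: "gauss_cutoff n \<omega> * (norm (qfourier I F \<omega>))\<^sup>2 = (\<integral>z. ?f (\<omega>, z) \<partial>?L2)" for \<omega>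
    by (simp add: norm_qfourier_square)
  show ?A
    unfolding eq by (rule L.integrable_fst'[OF fi])
  have G: "integrable ?L2 (\<lambda>z. n * std_normal_density (n * (snd z - fst z)) * inner (F (fst z)) (F (snd z)))"
  proof (rule Bochner_Integration.integrable_bound[OF integrable_mult_right[OF integrable_lborel_pair_mult[OF integrable_norm_F integrable_norm_F]]])
    show "AE z in ?L2. norm (n * std_normal_density (n * (snd z - fst z)) * inner (F (fst z)) (F (snd z)))
       \<le> norm (n * (norm (F (fst z)) * norm (F (snd z))))"
      using n normal_density_inner_le
      by (intro AE_I2) (auto simp: abs_mult mult.assoc intro!: mult_left_mono)
  qed measurable
  have "(\<integral>\<omega>. gauss_cutoff n \<omega> * (norm (qfourier I F \<omega>))\<^sup>2 \<partial>lborel) = (\<integral>z. \<integral>\<omega>. ?f (\<omega>, z) \<partial>lborel \<partial>?L2)"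
    unfolding eq using L.Fubini_integral[of "\<lambda>\<omega> z. gauss_cutoff n \<omega> * fourier_kernel \<omega> z"] fi by simp
  also have "\<dots> = (\<integral>z. n * std_normal_density (n * (snd z - fst z)) * inner (F (fst z)) (F (snd z)) \<partial>?L2)"
    unfolding fourier_kernel_def prod.case by (subst integral_gauss_cutoff_qcis[OF I n]) simp
  also have "\<dots> = (\<integral>t. \<integral>s. n * std_normal_density (n * (s - t)) * inner (F t) (F s) \<partial>lborel \<partial>lborel)"
    using lborel_pair.integral_fst'[OF G] by simp
  also have "\<dots> = (\<integral>t. \<integral>y. std_normal_density y * inner (F t) (F (t + y / n)) \<partial>lborel \<partial>lborel)"
  proof (rule Bochner_Integration.integral_cong[OF refl])
    fix t
    show "(\<integral>s. n * std_normal_density (n * (s - t)) * inner (F t) (F s) \<partial>lborel)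
        = (\<integral>y. std_normal_density y * inner (F t) (F (t + y / n)) \<partial>lborel)"
      \<comment> \<open>Substitution \<open>s = t + y / n\<close>; its Jacobian cancels the factor
        \<open>n\<close>.\<close>
      using n by (subst lborel_integral_real_affine[of "1 / n" _ t]) (simp_all add: mult.assoc)
  qed
  also have "\<dots> = (\<integral>y. \<integral>t. std_normal_density y * inner (F t) (F (t + y / n)) \<partial>lborel \<partial>lborel)"
  proof (rule lborel_pair.Fubini_integral[symmetric])
    have ti: "integrable lborel (\<lambda>y. norm (F (t + y / n)))" for t
      using lborel_integrable_real_affine[OF integrable_norm_F, of "1 / n" t] n by simp
    have tv: "(\<integral>y. norm (F (t + y / n)) \<partial>lborel) = n * (\<integral>s. norm (F s) \<partial>lborel)" for t
      using lborel_integral_real_affine[of "1 / n" "\<lambda>s. norm (F s)" t] n by simp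
    \<comment> \<open>By \<open>tv\<close> the integral over \<open>y\<close> is independent of
      \<open>t\<close>, so integrability of \<open>F\<close> alone dominates the sheared
      product.\<close>
    have H: "integrable (lborel \<Otimes>\<^sub>M lborel) (\<lambda>z. norm (F (fst z)) * norm (F (fst z + snd z / n)))"
      by (rule lborel_pair.Fubini_integrable) (use ti integrable_norm_F in \<open>simp_all add: tv abs_mult\<close>)
    show "integrable (lborel \<Otimes>\<^sub>M lborel) (\<lambda>(t, y). std_normal_density y * inner (F t) (F (t + y / n)))"
    proof (rule Bochner_Integration.integrable_bound[OF H])
      show "AE z in lborel \<Otimes>\<^sub>M lborel. norm (case z of (t, y) \<Rightarrow> std_normal_density y * inner (F t) (F (t + y / n)))
          \<le> norm (norm (F (fst z)) * norm (F (fst z + snd z / n)))"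
        using normal_density_inner_le by (intro AE_I2) (auto simp: abs_mult)
    qed measurable
  qed
  also have "\<dots> = (\<integral>y. std_normal_density y * (\<integral>t. inner (F t) (F (t + y / n)) \<partial>lborel) \<partial>lborel)"
    by simp
  finally show ?B .
qed

text \<open>Let the cutoff parameter grow in \<open>gauss_cutoff_qfourier\<close>. The
  autocorrelation average tends to the squared norm of \<open>F\<close> by dominated convergence;
  monotone convergence on the frequency side then gives both integrability and the value.\<close>

lemma plancherel_qfourier:
  assumes int2: "integrable lborel (\<lambda>t. (norm (F t))\<^sup>2)"
  shows "has_bochner_integral lborel (\<lambda>\<omega>. (norm (qfourier I F \<omega>))\<^sup>2) (\<integral>t. (norm (F t))\<^sup>2 \<partial>lborel)"
proof -
  let ?N = "\<integral>t. (norm (F t))\<^sup>2 \<partial>lborel"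
  \<comment> \<open>The successor keeps the cutoff parameter positive for every index.\<close>
  let ?n = "\<lambda>k. real (Suc k)"
  define A where "A h = (\<integral>t. inner (F t) (F (t + h)) \<partial>lborel)" for h
  have [measurable]: "A \<in> borel_measurable borel" unfolding A_def by measurable
  \<comment> \<open>This bound, uniform in the shift, is the source of the majorant below; it is
    Cauchy-Schwarz and the arithmetic-geometric mean inequality, followed by translation
    invariance.\<close>
  have A_le: "\<bar>A h\<bar> \<le> ?N" for h
  proof -
    note ti = integrable_translate[OF int2, of h]
    have inner_int: "integrable lborel (\<lambda>t. inner (F t) (F (t + h)))"
      by (rule integrable_inner_L2) (use int2 ti in simp_all)
    have "norm (A h) \<le> (\<integral>t. norm (inner (F t) (F (t + h))) \<partial>lborel)"
      unfolding A_def by (rule integral_norm_bound)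
    also have "\<dots> \<le> (\<integral>t. ((norm (F t))\<^sup>2 + (norm (F (t + h)))\<^sup>2) / 2 \<partial>lborel)"
    proof (rule integral_mono)
      show "norm (inner (F t) (F (t + h))) \<le> ((norm (F t))\<^sup>2 + (norm (F (t + h)))\<^sup>2) / 2" for t
        using Cauchy_Schwarz_ineq2[of "F t" "F (t + h)"] sum_squares_bound[of "norm (F t)" "norm (F (t + h))"]
        by (simp add: mult.assoc)
    qed (use inner_int int2 ti in simp_all)
    also have "\<dots> = ?N"
      using int2 ti integral_translate[of "\<lambda>t. (norm (F t))\<^sup>2" h] by simp
    finally show ?thesis by simp
  qed
  have lim: "(\<lambda>k. \<integral>y. std_normal_density y * A (y / ?n k) \<partial>lborel) \<longlonglongrightarrow> (\<integral>y. std_normal_density y * ?N \<partial>lborel)"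
  proof (rule integral_dominated_convergence[where w="\<lambda>y. std_normal_density y * ?N"])
    show "integrable lborel (\<lambda>y. std_normal_density y * ?N)" by simp
    show "AE y in lborel. (\<lambda>k. std_normal_density y * A (y / ?n k)) \<longlonglongrightarrow> std_normal_density y * ?N"
    proof (intro AE_I2 tendsto_mult tendsto_const)
      fix y :: real
      have "(\<lambda>k. y / ?n k) \<longlonglongrightarrow> 0"
        using LIMSEQ_Suc[OF lim_const_over_n[of y]] by simp
      then show "(\<lambda>k. A (y / ?n k)) \<longlonglongrightarrow> ?N"
        unfolding A_def by (intro autocorrelation_tendsto int2) simp_all
    qed
    show "AE y in lborel. norm (std_normal_density y * A (y / ?n k)) \<le> std_normal_density y * ?N" for k
      using A_le by (intro AE_I2) (auto simp: abs_mult intro!: mult_left_mono)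
  qed measurable
  have "(\<integral>y. std_normal_density y * ?N \<partial>lborel) = ?N"
    using integral_normal_density[of 1 0] by simp
  with lim have lim: "(\<lambda>k. \<integral>\<omega>. gauss_cutoff (?n k) \<omega> * (norm (qfourier I F \<omega>))\<^sup>2 \<partial>lborel) \<longlonglongrightarrow> ?N"
    by (simp add: gauss_cutoff_qfourier(2) A_def[symmetric] del: of_nat_Suc)
  show ?thesis
  proof (rule has_bochner_integral_monotone_convergence[OF _ _ _ lim])
    show "integrable lborel (\<lambda>\<omega>. gauss_cutoff (?n k) \<omega> * (norm (qfourier I F \<omega>))\<^sup>2)" for k
      by (rule gauss_cutoff_qfourier) simp
    have "gauss_cutoff (?n i) \<omega> \<le> gauss_cutoff (?n j) \<omega>" if "i \<le> j" for i j \<omega>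
    proof -
      have "(2 * pi * \<omega>)\<^sup>2 / (?n j)\<^sup>2 \<le> (2 * pi * \<omega>)\<^sup>2 / (?n i)\<^sup>2"
        using that by (intro divide_left_mono power_mono) auto
      then show ?thesis by (simp add: gauss_cutoff_def power_divide)
    qed
    then show "AE \<omega> in lborel. mono (\<lambda>k. gauss_cutoff (?n k) \<omega> * (norm (qfourier I F \<omega>))\<^sup>2)"
      by (intro AE_I2 monoI mult_right_mono) auto
    have "(\<lambda>k. gauss_cutoff (?n k) \<omega>) \<longlonglongrightarrow> 1" for \<omega>
    proof -
      have lim0: "(\<lambda>k. 2 * pi * \<omega> / ?n k) \<longlonglongrightarrow> 0"
        by (rule LIMSEQ_Suc[OF lim_const_over_n])
      show ?thesis
        unfolding gauss_cutoff_def
        using tendsto_exp[OF tendsto_divide[OF tendsto_minus[OF tendsto_power[OF lim0, of 2]] tendsto_const[of 2]]]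
        by simp
    qed
    then show "AE \<omega> in lborel. (\<lambda>k. gauss_cutoff (?n k) \<omega> * (norm (qfourier I F \<omega>))\<^sup>2) \<longlonglongrightarrow> (norm (qfourier I F \<omega>))\<^sup>2"
      using tendsto_mult[OF _ tendsto_const, of _ 1] by (intro AE_I2) fastforce
  qed measurable
qed

end

section \<open>Borel representatives, Gaussian windows and the short-time Fourier transform\<close>

lemma completion_ex_borel_measurable_euclidean:
  fixes f :: "'a \<Rightarrow> 'b::euclidean_space"
  assumes f: "f \<in> borel_measurable (completion M)"
  obtains f' where "f' \<in> borel_measurable M" "AE x in M. f x = f' x"
proof -
  \<comment> \<open>Coordinates are real-valued and are treated one at a time; as
    \<open>Basis\<close> is finite, the union of the exceptional sets is null.\<close>
  have "\<exists>g\<in>borel_measurable M. AE x in M. f x \<bullet> b = g x" for b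
    using f by (intro completion_ex_borel_measurable_real) simp
  then obtain g where g [measurable]: "\<And>b. g b \<in> borel_measurable M"
    and eq: "\<And>b. AE x in M. f x \<bullet> b = g b x"
    by metis
  have "AE x in M. \<forall>b\<in>Basis. f x \<bullet> b = g b x"
    using eq by (intro AE_finite_allI) auto
  then have "AE x in M. f x = (\<Sum>b\<in>Basis. g b x *\<^sub>R b)"
  proof eventually_elim
    case (elim x)
    then have "(\<Sum>b\<in>Basis. g b x *\<^sub>R b) = (\<Sum>b\<in>Basis. (f x \<bullet> b) *\<^sub>R b)" by simp
    then show ?case by (simp add: euclidean_representation)
  qed
  moreover have "(\<lambda>x. \<Sum>b\<in>Basis. g b x *\<^sub>R b) \<in> borel_measurable M" by measurable
  ultimately show thesis using that by blast
qed

definition gauss_window :: "real \<Rightarrow> (real \<Rightarrow> quat) \<Rightarrow> real \<Rightarrow> quat" where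
  "gauss_window x f t = exp (- pi * (t - x)\<^sup>2) *\<^sub>R f t"

lemma gaussian_2pi:
  "has_bochner_integral lborel (\<lambda>x. exp (- 2 * pi * (t - x)\<^sup>2)) (1 / sqrt 2)"
proof -
  \<comment> \<open>Chosen so that \<open>2 * \<sigma>\<^sup>2 = 1 / (2 * pi)\<close>, which gives
    the normal density the exponent \<open>- 2 * pi * (t - x)\<^sup>2\<close>.\<close>
  define \<sigma> where "\<sigma> = 1 / (2 * sqrt pi)"
  have \<sigma>: "\<sigma> > 0" "\<sigma>\<^sup>2 = 1 / (4 * pi)" by (simp_all add: \<sigma>_def power_divide power_mult_distrib)
  have "exp (- 2 * pi * (t - x)\<^sup>2) = normal_density t \<sigma> x / sqrt 2" for x
    by (simp add: normal_density_def \<sigma>(2) real_sqrt_divide power2_commute[of x t])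
  then show ?thesis
    using \<sigma>(1) by (simp add: has_bochner_integral_iff)
qed

text \<open>The first claim makes the Fourier integral converge absolutely, the second feeds
  Plancherel. A product of two square integrable functions is integrable, and the window is at most
  1.\<close>

lemma gauss_window_L1_L2:
  assumes [measurable]: "f \<in> borel_measurable borel" and int: "integrable lborel (\<lambda>t. (norm (f t))\<^sup>2)"
  shows "integrable lborel (gauss_window x f)" "integrable lborel (\<lambda>t. (norm (gauss_window x f t))\<^sup>2)"
proof -
  have sq: "exp (- pi * (t - x)\<^sup>2) ^ 2 = exp (- 2 * pi * (x - t)\<^sup>2)" for t
    by (simp add: power2_commute[of x t] flip: exp_double)
  have gi: "integrable lborel (\<lambda>t. exp (- 2 * pi * (x - t)\<^sup>2))"
    using gaussian_2pi[of x] by (simp add: has_bochner_integral_iff)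
  show "integrable lborel (gauss_window x f)"
  proof (rule Bochner_Integration.integrable_bound)
    show "integrable lborel (\<lambda>t. exp (- 2 * pi * (x - t)\<^sup>2) + (norm (f t))\<^sup>2)"
      by (intro Bochner_Integration.integrable_add gi int)
    show "AE t in lborel. norm (gauss_window x f t) \<le> norm (exp (- 2 * pi * (x - t)\<^sup>2) + (norm (f t))\<^sup>2)"
    proof (rule AE_I2)
      fix t
      have "2 * (exp (- pi * (t - x)\<^sup>2) * norm (f t)) \<le> exp (- pi * (t - x)\<^sup>2) ^ 2 + (norm (f t))\<^sup>2"
        using sum_squares_bound[of "exp (- pi * (t - x)\<^sup>2)" "norm (f t)"] by (simp only: mult.assoc)
      moreover have "0 \<le> exp (- pi * (t - x)\<^sup>2) * norm (f t)" by simp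
      ultimately have "exp (- pi * (t - x)\<^sup>2) * norm (f t) \<le> exp (- 2 * pi * (x - t)\<^sup>2) + (norm (f t))\<^sup>2"
        unfolding sq by linarith
      then show "norm (gauss_window x f t) \<le> norm (exp (- 2 * pi * (x - t)\<^sup>2) + (norm (f t))\<^sup>2)"
        by (simp add: gauss_window_def)
    qed
    show "gauss_window x f \<in> borel_measurable lborel"
      unfolding gauss_window_def by measurable
  qed
  show "integrable lborel (\<lambda>t. (norm (gauss_window x f t))\<^sup>2)"
    by (rule Bochner_Integration.integrable_bound[OF int])
       (auto simp: gauss_window_def power_mult_distrib intro!: mult_left_le_one_le power_le_one)
qed

text \<open>Since \<open>2 powr (3/4)\<close> is \<open>sqrt 2 * 2 powr (1/4)\<close>, this is
  \<open>sqrt 2\<close> times the usual transform with the window \<phi> of norm 1, which explains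
  the factor 2 in the final identity.\<close>

definition stft :: "quat \<Rightarrow> (real \<Rightarrow> quat) \<Rightarrow> real \<times> real \<Rightarrow> quat" where
  "stft I f z = 2 powr (3/4) *\<^sub>R qfourier I (gauss_window (fst z) f) (snd z)"

lemma borel_measurable_stft [measurable]:
  assumes [measurable]: "f \<in> borel_measurable borel"
  shows "stft I f \<in> borel_measurable borel"
proof -
  have "stft I f \<in> borel_measurable (borel \<Otimes>\<^sub>M borel)"
    unfolding stft_def qfourier_def gauss_window_def by measurable
  then show ?thesis by (simp add: borel_prod)
qed

text \<open>The kernel lies in the commutative plane spanned by 1 and \<open>I\<close>, so its
  exponential factors into a real part and a phase. What remains beside the windowed Fourier kernel
  is exactly what the prefactors in \<open>qstft\<close> cancel.\<close>

lemma segal_bargmann_integrand: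
  assumes I: "I \<in> imag_sphere"
  shows "(2 powr (3/4)) *\<^sub>R exp (- (pi *\<^sub>R ((qcnj (of_real x + I * of_real \<omega>) /\<^sub>R sqrt 2)\<^sup>2 + of_real (t\<^sup>2)))
      + (2 * pi * sqrt 2) *\<^sub>R (qcnj (of_real x + I * of_real \<omega>) /\<^sub>R sqrt 2 * of_real t)) * y
    = (2 powr (3/4) * exp (pi * (x\<^sup>2 + \<omega>\<^sup>2) / 2)) *\<^sub>R (qcis I (pi * x * \<omega>)
        * (qcis I (- 2 * pi * \<omega> * t) * (exp (- pi * (t - x)\<^sup>2) *\<^sub>R y)))"
proof -
  have II: "I * I = - 1" using I by (simp add: imag_sphere_def power2_eq_square)
  have cnj: "qcnj (of_real x + I * of_real \<omega>) = x *\<^sub>R 1 - \<omega> *\<^sub>R I"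
    by (simp only: quat_eq_iff qcnj_def of_real_quat plus_quat_def times_quat_def minus_quat_def
        scaleR_quat_def one_quat_def quat.sel)
      (simp add: imag_sphere_components(1)[OF I])
  have sq: "((x *\<^sub>R 1 - \<omega> *\<^sub>R I) /\<^sub>R sqrt 2)\<^sup>2 = ((x\<^sup>2 - \<omega>\<^sup>2) / 2) *\<^sub>R 1 - (x * \<omega>) *\<^sub>R I"
  proof -
    have "((x *\<^sub>R 1 - \<omega> *\<^sub>R I) /\<^sub>R sqrt 2)\<^sup>2 = (1 / 2) *\<^sub>R ((x *\<^sub>R 1 - \<omega> *\<^sub>R I) * (x *\<^sub>R 1 - \<omega> *\<^sub>R I))"
      unfolding power2_eq_square mult_scaleR_left mult_scaleR_right scaleR_scaleR
      by (simp add: field_simps)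
    also have "(x *\<^sub>R 1 - \<omega> *\<^sub>R I) * (x *\<^sub>R 1 - \<omega> *\<^sub>R I) = (x\<^sup>2 - \<omega>\<^sup>2) *\<^sub>R 1 - (2 * (x * \<omega>)) *\<^sub>R I"
    proof -
      have "(2 * (x * \<omega>)) *\<^sub>R I = (x * \<omega>) *\<^sub>R I + (x * \<omega>) *\<^sub>R I" by (simp flip: scaleR_add_left)
      then show ?thesis by (simp add: algebra_simps II power2_eq_square)
    qed
    finally show ?thesis by (simp add: scaleR_diff_right)
  qed
  have lin: "(2 * pi * sqrt 2) *\<^sub>R ((x *\<^sub>R 1 - \<omega> *\<^sub>R I) /\<^sub>R sqrt 2 * of_real t)
      = (2 * pi * x * t) *\<^sub>R 1 - (2 * pi * \<omega> * t) *\<^sub>R I"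
    by (simp add: of_real_def algebra_simps)
  \<comment> \<open>Real and imaginary parts of the exponent: \<open>a\<close> arises by completing
    the square in \<open>t\<close>, and \<open>b\<close> collects the phase from the square of the
    argument and from the linear term.\<close>
  define a where "a = pi * (x\<^sup>2 + \<omega>\<^sup>2) / 2 - pi * (t - x)\<^sup>2"
  define b where "b = pi * x * \<omega> - 2 * pi * \<omega> * t"
  have "- (pi *\<^sub>R (((x\<^sup>2 - \<omega>\<^sup>2) / 2) *\<^sub>R 1 - (x * \<omega>) *\<^sub>R I + of_real (t\<^sup>2)))
      + ((2 * pi * x * t) *\<^sub>R 1 - (2 * pi * \<omega> * t) *\<^sub>R I)
    = (- pi * ((x\<^sup>2 - \<omega>\<^sup>2) / 2 + t\<^sup>2) + 2 * pi * x * t) *\<^sub>R 1 + b *\<^sub>R I"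
    by (simp add: b_def of_real_def algebra_simps diff_divide_distrib)
  also have "- pi * ((x\<^sup>2 - \<omega>\<^sup>2) / 2 + t\<^sup>2) + 2 * pi * x * t = a"
    by (simp add: a_def power2_eq_square field_simps)
  finally have arg: "- (pi *\<^sub>R (((x\<^sup>2 - \<omega>\<^sup>2) / 2) *\<^sub>R 1 - (x * \<omega>) *\<^sub>R I + of_real (t\<^sup>2)))
      + ((2 * pi * x * t) *\<^sub>R 1 - (2 * pi * \<omega> * t) *\<^sub>R I) = of_real a + b *\<^sub>R I"
    by (simp add: of_real_def)
  have "exp (of_real a + b *\<^sub>R I) = exp (of_real a) * exp (b *\<^sub>R I)"
    by (rule exp_add_commuting) (simp add: of_real_def)
  also have "\<dots> = exp a *\<^sub>R qcis I b"
    unfolding exp_scaleR_imag[OF I] exp_of_real by (simp only: scaleR_conv_of_real)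
  also have "\<dots> = (exp (pi * (x\<^sup>2 + \<omega>\<^sup>2) / 2) * exp (- pi * (t - x)\<^sup>2)) *\<^sub>R
      (qcis I (pi * x * \<omega>) * qcis I (- 2 * pi * \<omega> * t))"
    by (simp add: qcis_mult[OF I] a_def b_def flip: exp_add)
  finally have ex: "exp (of_real a + b *\<^sub>R I) = (exp (pi * (x\<^sup>2 + \<omega>\<^sup>2) / 2) * exp (- pi * (t - x)\<^sup>2)) *\<^sub>R
      (qcis I (pi * x * \<omega>) * qcis I (- 2 * pi * \<omega> * t))" .
  show ?thesis
    unfolding cnj sq lin arg ex by (simp add: mult.assoc)
qed

lemma norm_imag_sphere_square:
  assumes "I \<in> imag_sphere"
  shows "(norm (of_real x + I * of_real \<omega>))\<^sup>2 = x\<^sup>2 + \<omega>\<^sup>2"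
proof -
  have "(norm (of_real x + I * of_real \<omega>))\<^sup>2 = x\<^sup>2 + ((q_i I)\<^sup>2 + (q_j I)\<^sup>2 + (q_k I)\<^sup>2) * \<omega>\<^sup>2"
    using imag_sphere_components(1)[OF assms]
    by (simp add: norm_quat_def of_real_quat plus_quat_def times_quat_def power_mult_distrib distrib_right)
  then show ?thesis by (simp add: imag_sphere_components(2)[OF assms])
qed

text \<open>An integral ignores null sets, so replacing \<open>f\<close> by a Borel representative
  leaves every value of the transform unchanged. The result is an equality at every point of the
  plane.\<close>

lemma qstft_eq_stft:
  assumes I: "I \<in> imag_sphere" and f: "f \<in> borel_measurable lebesgue"
    and f' [measurable]: "f' \<in> borel_measurable borel"
    and ae: "AE t in lborel. f t = f' t" and int: "integrable lborel (\<lambda>t. (norm (f' t))\<^sup>2)"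
  shows "qstft I f = stft I f'"
proof (rule ext, clarify)
  fix x \<omega> :: real
  let ?c = "2 powr (3/4) * exp (pi * (x\<^sup>2 + \<omega>\<^sup>2) / 2)"
  define H where "H h t = ?c *\<^sub>R (qcis I (pi * x * \<omega>)
        * (qcis I (- 2 * pi * \<omega> * t) * gauss_window x h t))" for h t
  have [measurable]: "H f' \<in> borel_measurable borel"
    unfolding H_def gauss_window_def by measurable
  have [measurable]: "(\<lambda>t::real. t) \<in> borel_measurable lebesgue"
    by (intro measurable_completion) simp
  have "H f \<in> borel_measurable lebesgue"
    unfolding H_def gauss_window_def using f by measurable
  note W = gauss_window_L1_L2(1)[OF f' int, of x]
  have "segal_bargmann f (qcnj (of_real x + I * of_real \<omega>) /\<^sub>R sqrt 2) = integral\<^sup>L lebesgue (H f)"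
    unfolding segal_bargmann_def segal_bargmann_integrand[OF I] H_def gauss_window_def ..
  also have "\<dots> = integral\<^sup>L lebesgue (H f')"
  proof (rule integral_cong_AE)
    have "AE t in lebesgue. f t = f' t" using ae by (simp add: AE_completion_iff)
    then show "AE t in lebesgue. H f t = H f' t"
      by eventually_elim (simp add: H_def gauss_window_def)
    show "H f' \<in> borel_measurable lebesgue" by (intro measurable_completion) simp
  qed fact
  also have "\<dots> = integral\<^sup>L lborel (H f')" by (rule integral_completion) simp
  also have "\<dots> = ?c *\<^sub>R (qcis I (pi * x * \<omega>) * qfourier I (gauss_window x f') \<omega>)"
  proof -
    have "(\<integral>t. qcis I (pi * x * \<omega>) * (qcis I (- 2 * pi * \<omega> * t) * gauss_window x f' t) \<partial>lborel)
      = qcis I (pi * x * \<omega>) * qfourier I (gauss_window x f') \<omega>"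
      unfolding qfourier_def by (rule Bochner_Integration.integral_mult_right) (rule integrable_qcis_mult[OF I W])
    then show ?thesis unfolding H_def by (simp only: integral_scaleR_right)
  qed
  finally have S: "segal_bargmann f (qcnj (of_real x + I * of_real \<omega>) /\<^sub>R sqrt 2)
    = ?c *\<^sub>R (qcis I (pi * x * \<omega>) * qfourier I (gauss_window x f') \<omega>)" .
  have "exp (- (I * of_real (pi * x * \<omega>))) = qcis I (- (pi * x * \<omega>))"
    by (simp add: of_real_def flip: exp_scaleR_imag[OF I])
  then have "qstft I f (x, \<omega>) = qcis I (- (pi * x * \<omega>))
      * (?c *\<^sub>R (qcis I (pi * x * \<omega>) * qfourier I (gauss_window x f') \<omega>))
      * of_real (exp (- (pi * (x\<^sup>2 + \<omega>\<^sup>2) / 2)))"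
    by (simp add: qstft_def Let_def S norm_imag_sphere_square[OF I] del: of_real_mult)
  also have "\<dots> = (?c * exp (- (pi * (x\<^sup>2 + \<omega>\<^sup>2) / 2))) *\<^sub>R
      ((qcis I (- (pi * x * \<omega>)) * qcis I (pi * x * \<omega>)) * qfourier I (gauss_window x f') \<omega>)"
    by (simp add: of_real_def mult.assoc mult.commute)
  also have "?c * exp (- (pi * (x\<^sup>2 + \<omega>\<^sup>2) / 2)) = 2 powr (3/4)"
    by (simp add: exp_minus)
  also have "qcis I (- (pi * x * \<omega>)) * qcis I (pi * x * \<omega>) = 1"
    unfolding qcis_mult[OF I] by (simp add: qcis_def)
  also have "2 powr (3/4) *\<^sub>R (1 * qfourier I (gauss_window x f') \<omega>) = stft I f' (x, \<omega>)"
    by (simp add: stft_def)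
  finally show "qstft I f (x, \<omega>) = stft I f' (x, \<omega>)" .
qed

section \<open>The transform doubles squared norms\<close>

lemma stft_norm:
  assumes I: "I \<in> imag_sphere" and f [measurable]: "f \<in> borel_measurable borel"
    and int: "integrable lborel (\<lambda>t. (norm (f t))\<^sup>2)"
  shows "has_bochner_integral lborel (\<lambda>z. (norm (stft I f z))\<^sup>2) (2 * (\<integral>t. (norm (f t))\<^sup>2 \<partial>lborel))"
proof -
  have p2: "(2 powr (3/4))\<^sup>2 = 2 * sqrt (2::real)"
    using powr_add[of "2::real" 1 "1/2"] by (simp add: power2_eq_square powr_half_sqrt flip: powr_add)
  let ?e = "\<lambda>x t. 2 * sqrt 2 * (exp (- 2 * pi * (t - x)\<^sup>2) * (norm (f t))\<^sup>2)"
  have sq: "(norm (gauss_window x f t))\<^sup>2 = exp (- 2 * pi * (t - x)\<^sup>2) * (norm (f t))\<^sup>2" for x t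
    by (simp add: gauss_window_def power_mult_distrib flip: exp_double)
  \<comment> \<open>Plancherel in \<omega> for the windowed function at fixed \<open>x\<close>; the
    constant \<open>2 * sqrt 2\<close> is the square of \<open>2 powr (3/4)\<close>.\<close>
  have inner_int: "(\<integral>\<^sup>+\<omega>. ennreal ((norm (stft I f (x, \<omega>)))\<^sup>2) \<partial>lborel) = (\<integral>\<^sup>+t. ennreal (?e x t) \<partial>lborel)" for x
  proof -
    note W = gauss_window_L1_L2[OF f int, of x]
    note P = has_bochner_integral_mult_right[of "2 * sqrt 2", OF plancherel_qfourier[OF I W]]
    have "(\<integral>\<^sup>+\<omega>. ennreal ((norm (stft I f (x, \<omega>)))\<^sup>2) \<partial>lborel)
      = ennreal (2 * sqrt 2 * (\<integral>t. (norm (gauss_window x f t))\<^sup>2 \<partial>lborel))"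
      using P by (subst nn_integral_eq_integral)
        (auto simp: has_bochner_integral_iff stft_def power_mult_distrib p2)
    also have "\<dots> = (\<integral>\<^sup>+t. ennreal (?e x t) \<partial>lborel)"
      using W(2) unfolding sq by (subst nn_integral_eq_integral) auto
    finally show ?thesis .
  qed
  \<comment> \<open>The factor 2 arises here, as \<open>2 * sqrt 2\<close> times the Gaussian
    integral \<open>1 / sqrt 2\<close>.\<close>
  have window: "(\<integral>\<^sup>+x. ennreal (?e x t) \<partial>lborel) = ennreal (2 * (norm (f t))\<^sup>2)" for t
  proof -
    have "has_bochner_integral lborel (\<lambda>x. ?e x t) (2 * sqrt 2 * (1 / sqrt 2 * (norm (f t))\<^sup>2))"
      by (intro has_bochner_integral_mult_right has_bochner_integral_mult_left gaussian_2pi)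
    then show ?thesis
      by (subst nn_integral_eq_integral) (auto simp: has_bochner_integral_iff)
  qed
  have [measurable]: "stft I f \<in> borel_measurable (borel \<Otimes>\<^sub>M borel)"
    using borel_measurable_stft[OF f, of I] by (simp add: borel_prod)
  \<comment> \<open>Nonnegative integrals let Tonelli exchange \<open>x\<close> and
    \<open>t\<close>; the finite value then yields integrability on the plane.\<close>
  have "(\<integral>\<^sup>+z. ennreal ((norm (stft I f z))\<^sup>2) \<partial>lborel)
      = (\<integral>\<^sup>+x. \<integral>\<^sup>+\<omega>. ennreal ((norm (stft I f (x, \<omega>)))\<^sup>2) \<partial>lborel \<partial>lborel)"
    unfolding lborel_prod[symmetric] by (subst lborel.nn_integral_fst[symmetric]) simp_all
  also have "\<dots> = (\<integral>\<^sup>+t. \<integral>\<^sup>+x. ennreal (?e x t) \<partial>lborel \<partial>lborel)"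
    unfolding inner_int by (rule lborel_pair.Fubini') measurable
  also have "\<dots> = ennreal (2 * (\<integral>t. (norm (f t))\<^sup>2 \<partial>lborel))"
    unfolding window using int by (subst nn_integral_eq_integral) auto
  finally show ?thesis
    by (intro has_bochner_integral_nn_integral) auto
qed

section \<open>Right linearity and polarization to the quaternionic inner product\<close>

lemma gauss_window_add: "gauss_window x (\<lambda>t. f t + g t) = (\<lambda>t. gauss_window x f t + gauss_window x g t)"
  by (simp add: gauss_window_def scaleR_add_right fun_eq_iff)

lemma gauss_window_mult: "gauss_window x (\<lambda>t. f t * u) = (\<lambda>t. gauss_window x f t * u)"
  by (simp add: gauss_window_def fun_eq_iff)

lemma integrable_qcis_gauss_window:
  assumes "I \<in> imag_sphere" "f \<in> borel_measurable borel" "integrable lborel (\<lambda>t. (norm (f t))\<^sup>2)"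
  shows "integrable lborel (\<lambda>t. qcis I (a * t) * gauss_window x f t)"
  by (intro integrable_qcis_mult gauss_window_L1_L2(1) assms)

lemma stft_add:
  assumes I: "I \<in> imag_sphere"
    and f: "f \<in> borel_measurable borel" "integrable lborel (\<lambda>t. (norm (f t))\<^sup>2)"
    and g: "g \<in> borel_measurable borel" "integrable lborel (\<lambda>t. (norm (g t))\<^sup>2)"
  shows "stft I (\<lambda>t. f t + g t) z = stft I f z + stft I g z"
  unfolding stft_def qfourier_def gauss_window_add distrib_left
  by (simp only: Bochner_Integration.integral_add[OF integrable_qcis_gauss_window[OF I f]
        integrable_qcis_gauss_window[OF I g]] scaleR_add_right)

lemma stft_mult:
  assumes I: "I \<in> imag_sphere"
    and f: "f \<in> borel_measurable borel" "integrable lborel (\<lambda>t. (norm (f t))\<^sup>2)"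
  shows "stft I (\<lambda>t. f t * u) z = stft I f z * u"
proof -
  have "(\<integral>t. qcis I (- 2 * pi * snd z * t) * gauss_window (fst z) f t * u \<partial>lborel)
      = qfourier I (gauss_window (fst z) f) (snd z) * u"
    unfolding qfourier_def
    by (rule Bochner_Integration.integral_mult_left) (rule integrable_qcis_gauss_window[OF I f])
  then show ?thesis
    unfolding stft_def by (simp only: qfourier_def gauss_window_mult mult.assoc[symmetric] mult_scaleR_left)
qed

lemma inner_qcnj_mult: "inner (qcnj v * p) q = inner p (v * (q :: quat))"
  using inner_mult_left_quat[of 1 p v q] by simp

lemma norm_qcnj: "norm (qcnj q) = norm q"
  by (simp add: norm_quat_def qcnj_def)

lemma borel_measurable_qcnj [measurable (raw)]:
  assumes [measurable]: "F \<in> borel_measurable M"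
  shows "(\<lambda>x. qcnj (F x)) \<in> borel_measurable M"
proof -
  \<comment> \<open>Conjugation is twice the real part minus the identity, an expression built from
    measurable operations.\<close>
  have "qcnj q = (2 * inner q 1) *\<^sub>R 1 - q" for q
    by (simp add: quat_eq_iff qcnj_def inner_quat_def one_quat_def minus_quat_def scaleR_quat_def)
  then show ?thesis by simp
qed

lemma integrable_qcnj_mult:
  assumes [measurable]: "F \<in> borel_measurable M" "G \<in> borel_measurable M"
    and "integrable M (\<lambda>x. (norm (F x))\<^sup>2)" "integrable M (\<lambda>x. (norm (G x))\<^sup>2)"
  shows "integrable M (\<lambda>x. qcnj (G x) * F x)"
proof (rule Bochner_Integration.integrable_bound)
  show "integrable M (\<lambda>x. ((norm (F x))\<^sup>2 + (norm (G x))\<^sup>2) / 2)"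
    using assms by simp
  have "norm (G x) * norm (F x) \<le> ((norm (F x))\<^sup>2 + (norm (G x))\<^sup>2) / 2" for x
    using sum_squares_bound[of "norm (F x)" "norm (G x)"] by (simp add: ac_simps)
  then show "AE x in M. norm (qcnj (G x) * F x) \<le> norm (((norm (F x))\<^sup>2 + (norm (G x))\<^sup>2) / 2)"
    by (intro AE_I2) (simp add: norm_mult norm_qcnj)
qed measurable

text \<open>Polarization of \<open>stft_norm\<close>, applied to \<open>f\<close>, \<open>g\<close>
  and their sum.\<close>

lemma stft_inner:
  assumes I: "I \<in> imag_sphere"
    and f [measurable]: "f \<in> borel_measurable borel" and g [measurable]: "g \<in> borel_measurable borel"
    and int: "integrable lborel (\<lambda>t. (norm (f t))\<^sup>2)" "integrable lborel (\<lambda>t. (norm (g t))\<^sup>2)"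
  shows "(\<integral>z. inner (stft I f z) (stft I g z) \<partial>lborel) = 2 * (\<integral>t. inner (f t) (g t) \<partial>lborel)"
proof -
  note F = stft_norm[OF I f int(1), unfolded has_bochner_integral_iff]
  note G = stft_norm[OF I g int(2), unfolded has_bochner_integral_iff]
  have fg: "integrable lborel (\<lambda>t. (norm (f t + g t))\<^sup>2)"
    by (rule integrable_norm_add_square) (use int in simp_all)
  have "(\<lambda>t. f t + g t) \<in> borel_measurable borel" by measurable
  note FG = stft_norm[OF I this fg, unfolded has_bochner_integral_iff stft_add[OF I f int(1) g int(2)]]
  show ?thesis
    unfolding dot_norm using F G FG int fg by simp
qed

text \<open>A quaternion is determined by its real inner products with all \<open>u\<close>. Taking
  adjoints moves \<open>u\<close> to the right of \<open>g\<close>, and right linearity reduces the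
  claim to \<open>stft_inner\<close> for \<open>f\<close> and \<open>g t * u\<close>.\<close>

lemma stft_L2_inner:
  assumes I: "I \<in> imag_sphere"
    and f [measurable]: "f \<in> borel_measurable borel" and g [measurable]: "g \<in> borel_measurable borel"
    and int: "integrable lborel (\<lambda>t. (norm (f t))\<^sup>2)" "integrable lborel (\<lambda>t. (norm (g t))\<^sup>2)"
  shows "(\<integral>z. qcnj (stft I g z) * stft I f z \<partial>lborel) = 2 * (\<integral>t. qcnj (g t) * f t \<partial>lborel)"
proof (rule vector_eq_rdot[THEN iffD1], rule allI)
  fix u
  have gu: "integrable lborel (\<lambda>t. (norm (g t * u))\<^sup>2)"
    using int(2) by (simp add: norm_mult power_mult_distrib)
  note F = stft_norm[OF I f int(1), unfolded has_bochner_integral_iff]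
  note G = stft_norm[OF I g int(2), unfolded has_bochner_integral_iff]
  have L: "integrable lborel (\<lambda>z. qcnj (stft I g z) * stft I f z)"
    by (rule integrable_qcnj_mult) (use F G in simp_all)
  have R: "integrable lborel (\<lambda>t. qcnj (g t) * f t)"
    by (rule integrable_qcnj_mult) (use int in simp_all)
  have "inner (\<integral>z. qcnj (stft I g z) * stft I f z \<partial>lborel) u
      = (\<integral>z. inner (qcnj (stft I g z) * stft I f z) u \<partial>lborel)"
    by (rule integral_inner_left[symmetric]) (rule L)
  also have "\<dots> = (\<integral>z. inner (stft I f z) (stft I (\<lambda>t. g t * u) z) \<partial>lborel)"
    by (simp only: inner_qcnj_mult stft_mult[OF I g int(2)])
  also have "\<dots> = 2 * (\<integral>t. inner (f t) (g t * u) \<partial>lborel)"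
    by (rule stft_inner[OF I f _ int(1) gu]) measurable
  also have "\<dots> = 2 * (\<integral>t. inner (qcnj (g t) * f t) u \<partial>lborel)"
    by (simp only: inner_qcnj_mult)
  also have "(\<integral>t. inner (qcnj (g t) * f t) u \<partial>lborel) = inner (\<integral>t. qcnj (g t) * f t \<partial>lborel) u"
    by (rule integral_inner_left) (rule R)
  also have "2 * \<dots> = inner (2 * (\<integral>t. qcnj (g t) * f t \<partial>lborel)) u"
    by (simp only: mult_2 inner_add_left)
  finally show "inner (\<integral>z. qcnj (stft I g z) * stft I f z \<partial>lborel) u
      = inner (2 * (\<integral>t. qcnj (g t) * f t \<partial>lborel)) u" .
qed

section \<open>Return to the completed measure and the inner product identity\<close>

lemma L2_borel_representative:
  fixes f :: "'a::euclidean_space \<Rightarrow> quat"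
  assumes "f \<in> L2"
  obtains f' where "f' \<in> borel_measurable borel" "AE t in lborel. f t = f' t"
    "integrable lborel (\<lambda>t. (norm (f' t))\<^sup>2)"
proof -
  have f: "f \<in> borel_measurable lebesgue" "integrable lebesgue (\<lambda>x. (norm (f x))\<^sup>2)"
    using assms by (simp_all add: L2_def)
  obtain f' where f' [measurable]: "f' \<in> borel_measurable borel" and ae: "AE t in lborel. f t = f' t"
    using completion_ex_borel_measurable_euclidean[OF f(1)] by (auto simp: measurable_lborel1)
  have "AE t in lebesgue. (norm (f t))\<^sup>2 = (norm (f' t))\<^sup>2"
    unfolding AE_completion_iff using ae by eventually_elim simp
  moreover have "(\<lambda>t. (norm (f' t))\<^sup>2) \<in> borel_measurable lebesgue"
    by (intro measurable_completion) simp
  ultimately have "integrable lebesgue (\<lambda>t. (norm (f' t))\<^sup>2)"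
    using integrable_cong_AE[OF borel_measurable_integrable[OF f(2)]] f(2) by blast
  then have "integrable lborel (\<lambda>t. (norm (f' t))\<^sup>2)"
    by (subst (asm) integrable_completion) simp_all
  with f' ae show thesis using that by blast
qed

theorem proposition5p5:
  fixes I :: quat and f g :: "real \<Rightarrow> quat"
  assumes "I \<in> imag_sphere"
    and "f \<in> L2" and "g \<in> L2"
  shows "qstft I f \<in> L2 \<and> qstft I g \<in> L2
    \<and> L2_inner (qstft I f) (qstft I g) = 2 * L2_inner f g"
proof -
  note I = assms(1)
  have fm [measurable]: "f \<in> borel_measurable lebesgue" and gm [measurable]: "g \<in> borel_measurable lebesgue"
    using assms by (simp_all add: L2_def)
  obtain f' where f' [measurable]: "f' \<in> borel_measurable borel" and fae: "AE t in lborel. f t = f' t"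
    and fint: "integrable lborel (\<lambda>t. (norm (f' t))\<^sup>2)"
    using L2_borel_representative[OF assms(2)] .
  obtain g' where g' [measurable]: "g' \<in> borel_measurable borel" and gae: "AE t in lborel. g t = g' t"
    and gint: "integrable lborel (\<lambda>t. (norm (g' t))\<^sup>2)"
    using L2_borel_representative[OF assms(3)] .
  \<comment> \<open>These equalities hold everywhere, so no exceptional set has to be tracked on the
    plane.\<close>
  have V: "qstft I f = stft I f'" "qstft I g = stft I g'"
    using qstft_eq_stft[OF I fm f' fae fint] qstft_eq_stft[OF I gm g' gae gint] by auto
  have mem: "stft I h \<in> L2" if [measurable]: "h \<in> borel_measurable borel"
    and "integrable lborel (\<lambda>t. (norm (h t))\<^sup>2)" for h
    using stft_norm[OF I that] unfolding L2_def
    by (auto intro!: measurable_completion simp: integrable_completion has_bochner_integral_iff)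
  have "L2_inner (stft I f') (stft I g') = (\<integral>z. qcnj (stft I g' z) * stft I f' z \<partial>lborel)"
    unfolding L2_inner_def by (rule integral_completion) simp
  also have "\<dots> = 2 * (\<integral>t. qcnj (g' t) * f' t \<partial>lborel)"
    by (rule stft_L2_inner[OF I f' g' fint gint])
  also have "(\<integral>t. qcnj (g' t) * f' t \<partial>lborel) = integral\<^sup>L lebesgue (\<lambda>t. qcnj (g' t) * f' t)"
    by (rule integral_completion[symmetric]) simp
  \<comment> \<open>On the line the representatives agree with \<open>f\<close> and \<open>g\<close>
    almost everywhere only, which suffices under the integral.\<close>
  also have "\<dots> = L2_inner f g"
    unfolding L2_inner_def
  proof (rule integral_cong_AE)
    have "AE t in lebesgue. f t = f' t" "AE t in lebesgue. g t = g' t"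
      using fae gae by (simp_all add: AE_completion_iff)
    then show "AE t in lebesgue. qcnj (g' t) * f' t = qcnj (g t) * f t"
      by eventually_elim simp
    show "(\<lambda>t. qcnj (g' t) * f' t) \<in> borel_measurable lebesgue"
      by (intro measurable_completion) simp
  qed measurable
  finally show ?thesis
    using mem[OF f' fint] mem[OF g' gint] by (simp add: V)
qed

end
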